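(* In the $\mathcal{L}\mathcal{R}$-ending partisan subtraction game with subtraction set $S = \{2, 5\}$, let $G$ be the position consisting of a single pile of $n \ge 0$ tokens. Then the equivalence class of $G$ depends only on $n \bmod 7$ (period $7$), namely: $G \equiv *L$ if $n \equiv 0$, $G \equiv *R$ if $n \equiv 1$, $G \equiv \{*L\}$ if $n \equiv 2$, $G \equiv \{*R\}$ if $n \equiv 3$, $G \equiv *L$ if $n \equiv 4$, $G \equiv \{*L, \{*R\}\}$ if $n \equiv 5$, and $G \equiv \{*L, *R\}$ if $n \equiv 6 \pmod 7$.
   Context: Abstract positions are defined recursively: $*L$ and $*R$ are terminal positions; if $G_1,\dots,G_k$ ($k\ge 1$) are positions, then $\{G_1,\dots,G_k\}$ is a position with options $G_1,\dots,G_k$. Play: Left and Right move alternately, each choosing any option of the current position; when a terminal position is reached, Left wins if it is $*L$ and Right wins if it is $*R$. Disjunctive sum: $*L + *L = *R + *R = *L$, $*L + *R = *R + *L = *R$; if at least one of $G,H$ is non-terminal, $G+H$ has options all $G'+H$ ($G'$ an option of $G$) and all $G+H'$ ($H'$ an option of $H$). Outcome classes: $\mathcal{L}$, $\mathcal{R}$, $\mathcal{N}$, $\mathcal{P}$ (Left wins, Right wins, first player wins, second player wins, respectively); $o(G)$ is the outcome class. Equivalence: $G \equiv H$ iff $o(G+X) = o(H+X)$ for every abstract position $X$. The $\mathcal{L}\mathcal{R}$-ending partisan subtraction game with subtraction set $S$: a move consists of choosing a pile and removing $s \in S$ tokens from it (requiring $s \le$ pile size); both players have the same moves; when no move is possible,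 Left wins if the total number of remaining tokens is even and Right wins if it is odd. A single pile of $n$ tokens is identified with an abstract position recursively: if no move is possible it is $*L$ for $n$ even and $*R$ for $n$ odd; otherwise it is $\{P_{n-s} : s \in S, s \le n\}$, where $P_m$ is the position of a single pile with $m$ tokens. *)

theory Defs
  imports "HOL-Library.FSet"
begin

(* The datatype also contains the junk term Node {||} (no options, yet not terminal);
   the predicate position cuts out the genuine abstract positions, hereditarily. *)
datatype pos = StarL | StarR | Node (node_opts: "pos fset")

inductive position :: "pos \<Rightarrow> bool" where
  "position StarL"
| "position StarR"
| "A \<noteq> {||} \<Longrightarrow> (\<And>G. G |\<in>| A \<Longrightarrow> position G) \<Longrightarrow> position (Node A)"

fun options_of :: "pos \<Rightarrow> pos fset" where
  "options_of StarL = {||}"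
| "options_of StarR = {||}"
| "options_of (Node A) = A"

lemma size_option_less:
  assumes "H |\<in>| options_of G"
  shows "size H < size G"
proof (cases G)
  case (Node A)
  then have "H \<in> fset A" using assms by simp
  then have "Suc (size H) \<le> (\<Sum>x\<in>fset A. Suc (size x))"
    by (intro member_le_sum) auto
  then show ?thesis using Node by simp
qed (use assms in auto)

lemma fimage_fundef_cong [fundef_cong]:
  "A = B \<Longrightarrow> (\<And>x. x |\<in>| B \<Longrightarrow> f x = g x) \<Longrightarrow> f |`| A = g |`| B"
  by (rule fset.map_cong)

datatype player = Left | Right

(* wins p m G: player p can force a win in G when player m is to move. *)
function (sequential) wins :: "player \<Rightarrow> player \<Rightarrow> pos \<Rightarrow> bool" where
  "wins p m StarL = (p = Left)"
| "wins p m StarR = (p = Right)"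
| "wins p m (Node A) =
     (if m = p then \<exists>H |\<in>| A. wins p (if m = Left then Right else Left) H
      else \<forall>H |\<in>| A. wins p (if m = Left then Right else Left) H)"
  by pat_completeness auto
termination
  by (relation "measure (\<lambda>(p, m, G). size G)")
     (use size_option_less[of _ "Node _"] in \<open>auto simp del: pos.size\<close>)

lemma wins_determined: "wins Right m G \<longleftrightarrow> \<not> wins Left m G"
proof (induction G arbitrary: m)
  case (Node A)
  then show ?case by (cases m) auto
qed auto

datatype outcome = OutL | OutR | OutN | OutP

(* By wins_determined the final branch is exactly: the second player wins. *)
definition outcome :: "pos \<Rightarrow> outcome" where
  "outcome G =
     (if wins Left Left G \<and> wins Left Right G then OutL
      else if wins Right Left G \<and> wins Right Right G then OutR
      else if wins Left Left G \<and> wins Right Right G then OutN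
      else OutP)"

lemma outcome_OutP_iff: "outcome G = OutP \<longleftrightarrow> wins Right Left G \<and> wins Left Right G"
  by (auto simp: outcome_def wins_determined)

function (sequential) pos_sum :: "pos \<Rightarrow> pos \<Rightarrow> pos"  (infixl \<open>\<oplus>\<close> 65) where
  "StarL \<oplus> StarL = StarL"
| "StarR \<oplus> StarR = StarL"
| "StarL \<oplus> StarR = StarR"
| "StarR \<oplus> StarL = StarR"
| "G \<oplus> H = Node (((\<lambda>G'. G' \<oplus> H) |`| options_of G) |\<union>| ((\<lambda>H'. G \<oplus> H') |`| options_of H))"
  by pat_completeness auto
termination
  by (relation "measure (\<lambda>(G, H). size G + size H)")
     (use size_option_less in \<open>auto simp del: pos.size options_of.simps\<close>)

definition equivalent :: "pos \<Rightarrow> pos \<Rightarrow> bool"  (infix \<open>\<approx>\<close> 50) where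
  "G \<approx> H \<longleftrightarrow> (\<forall>X. position X \<longrightarrow> outcome (G \<oplus> X) = outcome (H \<oplus> X))"

(* Subtraction sets consist of positive integers; the guard 0 < s enforces this. *)
definition moves :: "nat fset \<Rightarrow> nat \<Rightarrow> nat fset" where
  "moves S n = ffilter (\<lambda>s. 0 < s \<and> s \<le> n) S"

function pile :: "nat fset \<Rightarrow> nat \<Rightarrow> pos" where
  "pile S n =
     (if moves S n = {||} then (if even n then StarL else StarR)
      else Node ((\<lambda>s. pile S (n - s)) |`| moves S n))"
  by pat_completeness auto
termination
  by (relation "measure snd") (auto simp: moves_def)

declare pile.simps [simp del]

lemma position_pile: "position (pile S n)"
proof (induction n rule: less_induct)
  case (less n)
  have "position (pile S (n - s))" if "s |\<in>| moves S n" for s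
    using that by (intro less) (auto simp: moves_def)
  then show ?case
    by (subst pile.simps) (auto intro!: position.intros)
qed

end

theory Submission
  imports Defs
begin

text \<open>
  Call an option of \<open>G\<close> reversible through \<open>K\<close> if it has itself an option equivalent to \<open>K\<close>.
  If \<open>G\<close> and \<open>K\<close> have the same options up to equivalence, apart from options of \<open>G\<close> that
  are reversible through \<open>K\<close>, then \<open>G \<approx> K\<close>: the player who wins \<open>K \<oplus> X\<close> copies the strategy
  in \<open>G \<oplus> X\<close> and answers a reversible move by returning to \<open>K\<close>. Copying only breaks down if
  \<open>K\<close> and \<open>X\<close> are both terminal while the winner still has to move in \<open>G\<close>, so for terminal \<open>K\<close>
  one also asks that \<open>G\<close> and \<open>K\<close> have the same outcome. Since a move by 2 answered by a move
  by 5 (or vice versa) removes 7 tokens, reversibility yields the period 7.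
\<close>

section \<open>Winning strategies and equivalence\<close>

abbreviation opp :: "player \<Rightarrow> player" where
  "opp m \<equiv> (if m = Left then Right else Left)"

lemma wins_opp: "wins (opp p) m G \<longleftrightarrow> \<not> wins p m G"
  by (cases p) (auto simp: wins_determined)

lemma outcome_eq_iff_wins: "outcome G = outcome H \<longleftrightarrow> (\<forall>p m. wins p m G = wins p m H)"
proof
  assume *: "outcome G = outcome H"
  have "wins Left m G = wins Left m H" for m
    using * by (cases m) (auto simp: outcome_def wins_determined split: if_split_asm)
  moreover from this have "wins Right m G = wins Right m H" for m
    by (simp add: wins_determined)
  ultimately show "\<forall>p m. wins p m G = wins p m H"
    by (intro allI, case_tac p) simp_all
qed (simp add: outcome_def)

lemma equivalent_iff_wins:
  "G \<approx> H \<longleftrightarrow> (\<forall>X p m. position X \<longrightarrow> wins p m (G \<oplus> X) = wins p m (H \<oplus> X))"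
  by (auto simp: equivalent_def outcome_eq_iff_wins)

lemma equivalent_refl: "G \<approx> G"
  by (simp add: equivalent_def)

lemma equivalent_sym: "G \<approx> H \<Longrightarrow> H \<approx> G"
  by (simp add: equivalent_def)

lemma equivalent_trans: "G \<approx> H \<Longrightarrow> H \<approx> K \<Longrightarrow> G \<approx> K"
  by (simp add: equivalent_def)

text \<open>
  The equations for \<open>Node A \<oplus> H\<close> with arbitrary \<open>H\<close> apply again below the binders on their
  right-hand side, hence loop as simplification rules.
\<close>

declare pos_sum.simps(5-) [simp del]

section \<open>Disjunctive sums\<close>

lemma sum_eq_Node_image:
  assumes "G \<notin> {StarL, StarR} \<or> H \<notin> {StarL, StarR}"
  shows "G \<oplus> H = Node (((\<lambda>G'. G' \<oplus> H) |`| options_of G) |\<union>| ((\<lambda>H'. G \<oplus> H') |`| options_of H))"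
proof (cases G)
  case (Node A)
  show ?thesis unfolding Node by (rule pos_sum.simps)
next
  case StarL
  with assms obtain B where "H = Node B" by (cases H) auto
  show ?thesis unfolding StarL \<open>H = Node B\<close> by (rule pos_sum.simps)
next
  case StarR
  with assms obtain B where "H = Node B" by (cases H) auto
  show ?thesis unfolding StarR \<open>H = Node B\<close> by (rule pos_sum.simps)
qed

text \<open>Terminal summands need no exception: if both are terminal, both sides are empty.\<close>

lemma options_of_sum:
  "options_of (G \<oplus> H) =
     ((\<lambda>G'. G' \<oplus> H) |`| options_of G) |\<union>| ((\<lambda>H'. G \<oplus> H') |`| options_of H)"
proof (cases "G \<notin> {StarL, StarR} \<or> H \<notin> {StarL, StarR}")
  case True
  then show ?thesis by (subst sum_eq_Node_image) simp_all
qed auto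

text \<open>This form expresses that the sum is not terminal, as \<open>wins_to_move_iff\<close> and
  \<open>wins_not_to_move_iff\<close> require.\<close>

lemma sum_eq_Node:
  assumes "G \<notin> {StarL, StarR} \<or> H \<notin> {StarL, StarR}"
  shows "G \<oplus> H = Node (options_of (G \<oplus> H))"
  using sum_eq_Node_image[OF assms] by simp

lemma sum_StarL_right: "G \<oplus> StarL = G"
proof (induction G)
  case (Node A)
  then have "(\<lambda>G'. G' \<oplus> StarL) |`| A = (\<lambda>G'. G') |`| A"
    by (intro fset.map_cong) auto
  then show ?case
    by (subst sum_eq_Node) (simp_all add: options_of_sum)
qed auto

text \<open>Adding \<open>StarR\<close> swaps the two kinds of terminal positions throughout, which
  amounts to exchanging the players.\<close>

lemma wins_sum_StarR: "wins p m (G \<oplus> StarR) = wins (opp p) (opp m) G"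
proof (induction G arbitrary: m)
  case (Node A)
  have "Node A \<oplus> StarR = Node ((\<lambda>G'. G' \<oplus> StarR) |`| A)"
    by (subst sum_eq_Node) (simp_all add: options_of_sum)
  with Node show ?case by (cases p; cases m) auto
qed (cases p; simp)+

text \<open>The test position \<open>StarL\<close> is neutral for sums.\<close>

lemma equivalent_imp_wins: "G \<approx> H \<Longrightarrow> wins p m G = wins p m H"
  using position.intros(1) unfolding equivalent_iff_wins by (metis sum_StarL_right)

section \<open>Reversible options\<close>

lemma wins_to_move_iff:
  assumes "G = Node (options_of G)"
  shows "wins p p G \<longleftrightarrow> (\<exists>H. H |\<in>| options_of G \<and> wins p (opp p) H)"
  by (cases G) (use assms in auto)

lemma wins_not_to_move_iff:
  assumes "G = Node (options_of G)" "m \<noteq> p"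
  shows "wins p m G \<longleftrightarrow> (\<forall>H. H |\<in>| options_of G \<longrightarrow> wins p p H)"
  by (cases G; cases p; cases m) (use assms in auto)

text \<open>Induction on \<open>X\<close> alone suffices: moves in \<open>Node A\<close> or
  \<open>K\<close> are handled by the assumed equivalences, with \<open>X\<close> unchanged.\<close>

lemma wins_sum_reversible:
  assumes fwd: "\<And>G'. G' |\<in>| A \<Longrightarrow>
      (\<exists>K'. K' |\<in>| options_of K \<and> G' \<approx> K') \<or> (\<exists>G''. G'' |\<in>| options_of G' \<and> G'' \<approx> K)"
    and bwd: "\<And>K'. K' |\<in>| options_of K \<Longrightarrow> \<exists>G'. G' |\<in>| A \<and> G' \<approx> K'"
    and terminal: "K \<in> {StarL, StarR} \<Longrightarrow> outcome (Node A) = outcome K"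
    and X: "position X"
    and wins: "wins p m (K \<oplus> X)"
  shows "wins p m (Node A \<oplus> X)"
  using X wins
proof (induction X arbitrary: m rule: measure_induct_rule[of size])
  case (less X)
  note eq = equivalent_iff_wins[THEN iffD1, rule_format, OF _ \<open>position X\<close>]
  have IH: "wins p m (Node A \<oplus> X')" if "X' |\<in>| options_of X" "wins p m (K \<oplus> X')" for X' m
  proof (rule less.IH)
    show "position X'"
      using less.prems(1) that(1) by cases auto
  qed (simp_all add: that size_option_less)
  show ?case
  proof (cases "K \<in> {StarL, StarR} \<and> X \<in> {StarL, StarR}")
    \<comment> \<open>Here \<open>K \<oplus> X\<close> is over while \<open>Node A\<close> is still
      to be played. A terminal \<open>X\<close> changes nothing or exchanges the players, so equal
      outcomes suffice.\<close>
    case True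
    then have "wins q k (Node A) = wins q k K" for q k
      using terminal outcome_eq_iff_wins by blast
    then show ?thesis
      using True less.prems(2) by (auto simp: sum_StarL_right wins_sum_StarR)
  next
    case False
    then have K: "K \<oplus> X = Node (options_of (K \<oplus> X))"
      by (intro sum_eq_Node) auto
    have G: "Node A \<oplus> X = Node (options_of (Node A \<oplus> X))"
      by (intro sum_eq_Node) auto
    show ?thesis
    proof (cases "m = p")
      case True
      \<comment> \<open>The winning move in \<open>K \<oplus> X\<close> is to be copied: by
        \<open>bwd\<close> if made in \<open>K\<close>, by the induction hypothesis if made in
        \<open>X\<close>.\<close>
      obtain Z where "Z |\<in>| options_of (K \<oplus> X)" and Z: "wins p (opp p) Z"
        using less.prems(2) True wins_to_move_iff[OF K] by blast
      then consider K' where "K' |\<in>| options_of K" "Z = K' \<oplus> X"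
        | X' where "X' |\<in>| options_of X" "Z = K \<oplus> X'"
        by (auto simp: options_of_sum)
      then have "\<exists>Z'. Z' |\<in>| options_of (Node A \<oplus> X) \<and> wins p (opp p) Z'"
      proof cases
        case 1
        then obtain G' where "G' |\<in>| A" "G' \<approx> K'" using bwd by blast
        then show ?thesis
          using 1 Z eq[of G' K'] by (intro exI[of _ "G' \<oplus> X"]) (auto simp: options_of_sum)
      next
        case 2
        then show ?thesis
          using Z IH by (intro exI[of _ "Node A \<oplus> X'"]) (auto simp: options_of_sum)
      qed
      then show ?thesis using True wins_to_move_iff[OF G] by blast
    next
      case False
      then have m: "m = opp p" by (cases m; cases p) auto
      have all: "wins p p Z" if "Z |\<in>| options_of (K \<oplus> X)" for Z
        using that less.prems(2) wins_not_to_move_iff[OF K False] by blast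
      have "wins p p Z" if "Z |\<in>| options_of (Node A \<oplus> X)" for Z
      proof -
        from that consider G' where "G' |\<in>| A" "Z = G' \<oplus> X"
          | X' where "X' |\<in>| options_of X" "Z = Node A \<oplus> X'"
          by (auto simp: options_of_sum)
        then show ?thesis
        proof cases
          case 1
          from fwd[OF 1(1)] show ?thesis
          proof (elim disjE exE conjE)
            fix K' assume "K' |\<in>| options_of K" "G' \<approx> K'"
            then show ?thesis using all[of "K' \<oplus> X"] eq[of G' K'] 1 by (auto simp: options_of_sum)
          next
            fix G'' assume *: "G'' |\<in>| options_of G'" "G'' \<approx> K"
            then have N: "G' \<oplus> X = Node (options_of (G' \<oplus> X))"
              by (intro sum_eq_Node) auto
            \<comment> \<open>After the reply \<open>G''\<close> the opponent is to move again,
              exactly as in \<open>K \<oplus> X\<close>, which \<open>p\<close> wins.\<close>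
            have "wins p (opp p) (G'' \<oplus> X)"
              using eq[OF *(2)] less.prems(2) m by simp
            moreover have "G'' \<oplus> X |\<in>| options_of (G' \<oplus> X)"
              using * by (auto simp: options_of_sum)
            ultimately show ?thesis
              using wins_to_move_iff[OF N] 1 by blast
          qed
        next
          case 2
          then show ?thesis using IH all[of "K \<oplus> X'"] by (auto simp: options_of_sum)
        qed
      qed
      then show ?thesis using wins_not_to_move_iff[OF G False] by blast
    qed
  qed
qed

lemma equivalent_reversible:
  assumes "\<And>G'. G' |\<in>| A \<Longrightarrow>
      (\<exists>K'. K' |\<in>| options_of K \<and> G' \<approx> K') \<or> (\<exists>G''. G'' |\<in>| options_of G' \<and> G'' \<approx> K)"
    and "\<And>K'. K' |\<in>| options_of K \<Longrightarrow> \<exists>G'. G' |\<in>| A \<and> G' \<approx> K'"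
    and "K \<in> {StarL, StarR} \<Longrightarrow> outcome (Node A) = outcome K"
  shows "Node A \<approx> K"
  unfolding equivalent_iff_wins
proof (intro allI impI iffI)
  fix X p m
  assume X: "position X"
  have R: "wins p m (Node A \<oplus> X)" if "wins p m (K \<oplus> X)" for p m
    by (rule wins_sum_reversible[OF _ _ _ X that]) (use assms in blast)+
  show "wins p m (Node A \<oplus> X)" if "wins p m (K \<oplus> X)"
    using that by (rule R)
  show "wins p m (K \<oplus> X)" if "wins p m (Node A \<oplus> X)"
    \<comment> \<open>By determinacy, the converse is the same transfer of wins applied to the
      opponent.\<close>
    using that R[of "opp p" m] wins_opp by blast
qed

section \<open>Piles with subtraction set {2, 5}\<close>

abbreviation pile25 :: "nat \<Rightarrow> pos" where
  "pile25 \<equiv> pile {|2, 5|}"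

lemma moves25: "moves {|2, 5|} n = (if n < 2 then {||} else if n < 5 then {|2|} else {|2, 5|})"
  by (auto simp: moves_def)

lemma pile25_eq:
  "pile25 n = (if n = 0 then StarL else if n = 1 then StarR
     else if n < 5 then Node {|pile25 (n - 2)|} else Node {|pile25 (n - 2), pile25 (n - 5)|})"
proof -
  have "n < 2 \<longleftrightarrow> n = 0 \<or> n = 1" by auto
  then show ?thesis by (subst pile.simps) (auto simp: moves25)
qed

definition pile25_class :: "nat \<Rightarrow> pos" where
  "pile25_class r =
     [StarL, StarR, Node {|StarL|}, Node {|StarR|}, StarL,
      Node {|StarL, Node {|StarR|}|}, Node {|StarL, StarR|}] ! r"

lemma pile25_equivalent_class: "pile25 n \<approx> pile25_class (n mod 7)"
proof (induction n rule: less_induct)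
  case (less n)
  \<comment> \<open>Below 7 only the piles 4 and 6 differ from their class representatives; the sole
    option of pile 4 reverses through \<open>StarL\<close>.\<close>
  have four: "pile25 4 \<approx> StarL"
  proof -
    have "pile25 4 = Node {|Node {|StarL|}|}"
      by (simp add: pile25_eq[of 4] pile25_eq[of 2] pile25_eq[of 0])
    moreover have "Node {|Node {|StarL|}|} \<approx> StarL"
      by (rule equivalent_reversible) (auto simp: equivalent_refl outcome_def)
    ultimately show ?thesis by simp
  qed
  show ?case
  proof (cases "n < 7")
    case True
    have "pile25 6 = Node {|pile25 4, StarR|}"
      by (simp add: pile25_eq[of 6] pile25_eq[of "Suc 0"])
    moreover have "Node {|pile25 4, StarR|} \<approx> Node {|StarL, StarR|}"
      using four equivalent_refl by (intro equivalent_reversible) auto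
    ultimately have six: "pile25 6 \<approx> Node {|StarL, StarR|}" by simp
    from True have "n \<in> {0, 1, 2, 3, 4, 5, 6}" by auto
    then show ?thesis
      using four six
      by (auto simp: pile25_class_def equivalent_refl finsert_commute
          pile25_eq[of 0] pile25_eq[of "Suc 0"] pile25_eq[of 2] pile25_eq[of 3] pile25_eq[of 5])
  next
    case False
    define r where "r = n mod 7"
    define K where "K = pile25_class r"
    have Node: "pile25 n = Node {|pile25 (n - 2), pile25 (n - 5)|}"
      using False by (subst pile25_eq) auto
    have "pile25 (n - 7) \<approx> K"
      using less[of "n - 7"] False by (simp add: K_def r_def le_mod_geq)
    moreover have "pile25 (n - 7) |\<in>| options_of (pile25 (n - 2))"
      using False by (subst (2) pile25_eq) auto
    moreover have "pile25 (n - 7) |\<in>| options_of (pile25 (n - 5))"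
      using False by (subst (2) pile25_eq) auto
    ultimately have reversible: "\<exists>G''. G'' |\<in>| options_of G' \<and> G'' \<approx> K"
      if "G' |\<in>| {|pile25 (n - 2), pile25 (n - 5)|}" for G'
      using that by blast
    \<comment> \<open>Modulo 7, removing 2 is adding 5 and removing 5 is adding 2; this avoids
      truncated subtraction on residues.\<close>
    have two: "pile25 (n - 2) \<approx> pile25_class ((r + 5) mod 7)"
    proof -
      have "n + 5 = (n - 2) + 7" using False by simp
      then have "(r + 5) mod 7 = (n - 2) mod 7"
        unfolding r_def by (simp only: mod_add_left_eq mod_add_self2)
      then show ?thesis using less[of "n - 2"] False by simp
    qed
    have five: "pile25 (n - 5) \<approx> pile25_class ((r + 2) mod 7)"
    proof -
      have "n + 2 = (n - 5) + 7" using False by simp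
      then have "(r + 2) mod 7 = (n - 5) mod 7"
        unfolding r_def by (simp only: mod_add_left_eq mod_add_self2)
      then show ?thesis using less[of "n - 5"] False by simp
    qed
    note wins_opts = equivalent_imp_wins[OF two] equivalent_imp_wins[OF five]
    have "r < 7" by (simp add: r_def)
    then have residues: "r \<in> {0, 1, 2, 3, 4, 5, 6}" by auto
    have bwd: "pile25 (n - 2) \<approx> K' \<or> pile25 (n - 5) \<approx> K'" if "K' |\<in>| options_of K" for K'
      using residues two five that unfolding K_def pile25_class_def
      by (elim insertE emptyE) (simp_all, auto)
    \<comment> \<open>This concerns the residues 0, 1 and 4. The winners in both options are read
      off from their classes, which determines the outcome of the pile.\<close>
    have terminal: "outcome (Node {|pile25 (n - 2), pile25 (n - 5)|}) = outcome K"
      if "K \<in> {StarL, StarR}"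
      using residues that unfolding K_def outcome_eq_iff_wins
      by (elim insertE emptyE; intro allI; case_tac p; case_tac m)
        (simp_all add: pile25_class_def wins_opts)
    have "Node {|pile25 (n - 2), pile25 (n - 5)|} \<approx> K"
    proof (rule equivalent_reversible)
      show "\<exists>G'. G' |\<in>| {|pile25 (n - 2), pile25 (n - 5)|} \<and> G' \<approx> K'"
        if "K' |\<in>| options_of K" for K'
        using bwd[OF that] by blast
    qed (use reversible terminal in blast)+
    then show ?thesis
      by (simp add: Node K_def r_def)
  qed
qed

theorem theorem4p2:
  fixes n :: nat
  shows "(\<forall>m. m mod 7 = n mod 7 \<longrightarrow> pile {|2, 5|} m \<approx> pile {|2, 5|} n)
    \<and> (n mod 7 = 0 \<longrightarrow> pile {|2, 5|} n \<approx> StarL)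
    \<and> (n mod 7 = 1 \<longrightarrow> pile {|2, 5|} n \<approx> StarR)
    \<and> (n mod 7 = 2 \<longrightarrow> pile {|2, 5|} n \<approx> Node {|StarL|})
    \<and> (n mod 7 = 3 \<longrightarrow> pile {|2, 5|} n \<approx> Node {|StarR|})
    \<and> (n mod 7 = 4 \<longrightarrow> pile {|2, 5|} n \<approx> StarL)
    \<and> (n mod 7 = 5 \<longrightarrow> pile {|2, 5|} n \<approx> Node {|StarL, Node {|StarR|}|})
    \<and> (n mod 7 = 6 \<longrightarrow> pile {|2, 5|} n \<approx> Node {|StarL, StarR|})"
proof (intro conjI allI impI)
  fix m assume "m mod 7 = n mod 7"
  then have "pile25 m \<approx> pile25_class (n mod 7)"
    using pile25_equivalent_class[of m] by simp
  then show "pile25 m \<approx> pile25 n"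
    using equivalent_sym[OF pile25_equivalent_class] by (rule equivalent_trans)
qed (use pile25_equivalent_class[of n] in \<open>simp_all add: pile25_class_def\<close>)

end
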